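(* Let $G=(V,E)$ be a connected graph of order $n\geq 3$. Let $U\subset V$ be a vertex subset with $m=|U|<n$, and let $G[U]=(U,E[U])$ be its induced subgraph. Then $$\sum_{i=1}^{m+1} q_i(G)\geq\sum_{u\in U} d_u+m-|E[U]|.$$
   Context: $Q(G)=D+A$ is the signless Laplacian of $G$ (degree diagonal matrix plus adjacency matrix), with eigenvalues $q_1(G)\geq\cdots\geq q_n(G)$; $d_u$ is the degree of $u$ in $G$; $E[U]$ is the set of edges of $G$ with both endpoints in $U$. *)

theory Defs
  imports
    "Graph_Theory.Digraph_Component"
    "Jordan_Normal_Form.Char_Poly"
begin

text \<open>
  A finite simple graph is a Digraph.graph: a finite, loop-free symmetric digraph without
  parallel arcs. Each undirected edge is a pair of opposite arcs, so the degree of a vertex is its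
  out-degree, whereas edges have to be counted as unordered pairs of end points.
\<close>

definition edges :: "('a, 'b) pre_digraph \<Rightarrow> 'a set set" where
  "edges G = (\<lambda>a. {tail G a, head G a}) ` arcs G"

text \<open>
  Matrices of a graph are taken with respect to an enumeration vs of its vertices; another
  enumeration permutes rows and columns simultaneously and leaves the eigenvalues unchanged.
\<close>

definition adjacency_mat :: "'a list \<Rightarrow> ('a, 'b) pre_digraph \<Rightarrow> real mat" where
  "adjacency_mat vs G = mat (length vs) (length vs)
     (\<lambda>(i, j). if vs ! i \<rightarrow>\<^bsub>G\<^esub> vs ! j then 1 else 0)"

definition degree_mat :: "'a list \<Rightarrow> ('a, 'b) pre_digraph \<Rightarrow> real mat" where
  "degree_mat vs G = mat (length vs) (length vs)
     (\<lambda>(i, j). if i = j then real (out_degree G (vs ! i)) else 0)"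

definition signless_laplacian :: "'a list \<Rightarrow> ('a, 'b) pre_digraph \<Rightarrow> real mat" where
  "signless_laplacian vs G = degree_mat vs G + adjacency_mat vs G"

text \<open>
  Non-increasing list of the real eigenvalues, repeated according to algebraic multiplicity. For a
  real symmetric matrix it has as many entries as the matrix has rows.
\<close>

definition eigenvalues_desc :: "real mat \<Rightarrow> real list" where
  "eigenvalues_desc A = rev (sorted_list_of_multiset (proots (char_poly A)))"

text \<open>The i-th largest eigenvalue, counted from 1.\<close>

definition q_eigenvalue :: "'a list \<Rightarrow> ('a, 'b) pre_digraph \<Rightarrow> nat \<Rightarrow> real" where
  "q_eigenvalue vs G i = eigenvalues_desc (signless_laplacian vs G) ! (i - 1)"

end

theory Submission
  imports Defs "Jordan_Normal_Form.Schur_Decomposition" "HOL-Analysis.Convex"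
begin

no_notation inner (infix \<open>\<bullet>\<close> 70)

text \<open>
  Orient the edges inside U so that every vertex u of U becomes the centre of a nonempty star
  S u of edges, where each edge meeting U belongs to exactly one star: since G is connected and U is
  not the whole vertex set, a spanning forest rooted outside U provides each u with at least its
  parent edge. Then the star sizes sum up to the degree sum over U minus |E[U]|. The vector y u of
  the star centred at u with s leaves, with entry s at u and 1 at the leaves, divided by sqrt s, has
  squared norm s + 1, and by Cauchy--Schwarz the sum of the forms (x . y u)^2 is bounded by the
  quadratic form of Q. A variational argument in an eigenbasis of Q turns this domination into the
  lower bound for the sum of the leading eigenvalues.
\<close>

section \<open>Diagonalization of real symmetric matrices\<close>

text \<open>Prepares the deflation step of the spectral theorem. Gram--Schmidt applied to a basis
  starting with \<open>v\<close> keeps its first vector, so it remains to normalize the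
  columns.\<close>

lemma orthogonal_mat_first_col:
  fixes v :: "real vec"
  assumes v: "v \<in> carrier_vec n" and v0: "v \<noteq> 0\<^sub>v n"
  shows "\<exists>W \<in> carrier_mat n n. W\<^sup>T * W = 1\<^sub>m n \<and> col W 0 = (1 / sqrt (v \<bullet> v)) \<cdot>\<^sub>v v"
proof -
  interpret cof_vec_space n "TYPE(real)" .
  define b where "b = basis_completion v"
  define ws where "ws = gram_schmidt n b"
  from basis_completion[OF v v0, folded b_def]
  have b: "set b \<subseteq> carrier_vec n" and dist: "distinct b" and indep: "\<not> lin_dep (set b)"
    and len_b: "length b = n" and hdb: "hd b = v"
    by auto
  from v v0 have n: "n \<noteq> 0" by auto
  with len_b hdb obtain bs where bv: "b = v # bs" by (cases b) auto
  have hdws: "hd ws = v" using gram_schmidt_hd[OF v, of bs] by (simp add: ws_def bv)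
  from gram_schmidt_result[OF b dist indep ws_def]
  have ws: "set ws \<subseteq> carrier_vec n" and orth: "corthogonal ws" and len: "length ws = n"
    by (auto simp: len_b)
  have ws0: "ws ! 0 = v" using hdws len n by (cases ws) auto
  define W where "W = mat n n (\<lambda>(i, j). ws ! j $ i / sqrt (ws ! j \<bullet> ws ! j))"
  have colW: "col W j = (1 / sqrt (ws ! j \<bullet> ws ! j)) \<cdot>\<^sub>v ws ! j" if "j < n" for j
  proof -
    have "ws ! j \<in> carrier_vec n" using ws len that by auto
    thus ?thesis using that by (intro eq_vecI) (auto simp: W_def)
  qed
  have W: "W \<in> carrier_mat n n" by (simp add: W_def)
  have "W\<^sup>T * W = 1\<^sub>m n"
  proof (rule eq_matI)
    fix i j assume "i < dim_row (1\<^sub>m n :: real mat)" "j < dim_col (1\<^sub>m n :: real mat)"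
    hence i: "i < n" and j: "j < n" by auto
    have wi: "ws ! i \<in> carrier_vec n" and wj: "ws ! j \<in> carrier_vec n" using ws len i j by auto
    \<comment> \<open>\<open>corthogonal\<close> bundles pairwise orthogonality with nonvanishing
      self-products; the latter make the division by the norms legitimate.\<close>
    have o: "(ws ! i \<bullet> ws ! j = 0) = (i \<noteq> j)"
      using corthogonalD[OF orth, of i j] i j len by simp
    have nn: "ws ! i \<bullet> ws ! i \<ge> 0"
      by (simp add: scalar_prod_def sum_nonneg)
    have "(W\<^sup>T * W) $$ (i, j) = col W i \<bullet> col W j" using W i j by simp
    also have "\<dots> = (ws ! i \<bullet> ws ! j) / (sqrt (ws ! i \<bullet> ws ! i) * sqrt (ws ! j \<bullet> ws ! j))"
      using wi wj by (simp add: colW i j)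
    also have "\<dots> = 1\<^sub>m n $$ (i, j)"
      using o nn i j corthogonalD[OF orth, of i i] len by (cases "i = j") auto
    finally show "(W\<^sup>T * W) $$ (i, j) = 1\<^sub>m n $$ (i, j)" .
  qed (use W in auto)
  moreover have "col W 0 = (1 / sqrt (v \<bullet> v)) \<cdot>\<^sub>v v" using colW[of 0] n ws0 by simp
  ultimately show ?thesis using W by blast
qed

lemma orthogonal_mat_inverse:
  fixes P :: "real mat"
  assumes "P \<in> carrier_mat n n" and "P\<^sup>T * P = 1\<^sub>m n"
  shows "P * P\<^sup>T = 1\<^sub>m n"
  using mat_mult_left_right_inverse[of "P\<^sup>T" n P] assms by simp

lemma transpose_congruence_symmetric:
  fixes A :: "real mat"
  assumes "A \<in> carrier_mat n n" and "A\<^sup>T = A" and "W \<in> carrier_mat n n"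
  shows "(W\<^sup>T * A * W)\<^sup>T = W\<^sup>T * A * W"
  using assms by (simp add: transpose_mult[of _ n n _ n] assoc_mult_mat[of _ n n _ n _ n])

lemma linear_factors_nonzero: "(\<Prod>e\<leftarrow>es. [:- e, 1:]) \<noteq> (0 :: 'a :: idom poly)"
  by (auto simp: prod_list_zero_iff)

lemma length_linear_factors_char_poly:
  fixes A :: "'a :: idom mat"
  assumes "A \<in> carrier_mat n n" and "char_poly A = (\<Prod>e\<leftarrow>es. [:- e, 1:])"
  shows "length es = n"
proof -
  have "degree (\<Prod>e\<leftarrow>es. [:- e, 1:]) = length es"
  proof (induction es)
    case (Cons e es)
    thus ?case using degree_mult_eq[OF _ linear_factors_nonzero, of "[:- e, 1:]" es] by simp
  qed simp
  thus ?thesis using degree_monic_char_poly[OF assms(1)] assms(2) by simp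
qed

text \<open>Deflation: in an orthonormal basis starting with an eigenvector for the first root,
  symmetry splits off a 1 x 1 block, and the other block carries the remaining roots. Taking the
  factorization as a hypothesis lets the caller prescribe the order of the diagonal, which will be
  \<open>eigenvalues_desc A\<close>.\<close>

lemma real_symmetric_diagonalization:
  fixes A :: "real mat"
  assumes "A \<in> carrier_mat n n" and "A\<^sup>T = A" and "char_poly A = (\<Prod>e\<leftarrow>es. [:- e, 1:])"
  shows "\<exists>P \<in> carrier_mat n n. P\<^sup>T * P = 1\<^sub>m n \<and> P\<^sup>T * A * P = mat_diag n (\<lambda>i. es ! i)"
  using assms
proof (induction es arbitrary: n A)
  case Nil
  from length_linear_factors_char_poly[OF Nil(1,3)] have "n = 0" by simp
  thus ?case using Nil by (intro bexI[of _ "1\<^sub>m n"]) (auto intro!: eq_matI simp: mat_diag_def)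
next
  case (Cons e es n A)
  note A = Cons.prems(1) and sym = Cons.prems(2) and cp = Cons.prems(3)
  from length_linear_factors_char_poly[OF A cp]
  obtain k where n: "n = 1 + k" by auto
  have "eigenvalue A e" unfolding eigenvalue_root_char_poly[OF A] cp by simp
  then obtain v where v: "v \<in> carrier_vec n" "v \<noteq> 0\<^sub>v n" and ev: "A *\<^sub>v v = e \<cdot>\<^sub>v v"
    using A unfolding eigenvalue_def eigenvector_def by auto
  from orthogonal_mat_first_col[OF v] obtain W where W: "W \<in> carrier_mat n n"
    and WW: "W\<^sup>T * W = 1\<^sub>m n" and col0: "col W 0 = (1 / sqrt (v \<bullet> v)) \<cdot>\<^sub>v v"
    by blast
  have WT: "W\<^sup>T \<in> carrier_mat n n" using W by simp
  note WW' = orthogonal_mat_inverse[OF W WW]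
  define B where "B = W\<^sup>T * A * W"
  have B: "B \<in> carrier_mat n n" using A W by (simp add: B_def)
  have symB: "B\<^sup>T = B" unfolding B_def by (rule transpose_congruence_symmetric[OF A sym W])
  have eigW: "A *\<^sub>v col W 0 = e \<cdot>\<^sub>v col W 0"
    unfolding col0 mult_mat_vec[OF A v(1)] ev by (simp add: smult_smult_assoc mult.commute)
  \<comment> \<open>The first column of \<open>W\<close> is an eigenvector of \<open>A\<close>, so
    \<open>B\<close> maps the first unit vector to \<open>e\<close> times itself; symmetry of
    \<open>B\<close> then clears the first row as well.\<close>
  have B0: "B $$ (i, 0) = (if i = 0 then e else 0)" if i: "i < n" for i
  proof -
    have "B $$ (i, 0) = col W i \<bullet> col (A * W) 0"
      using A W i n unfolding B_def assoc_mult_mat[OF WT A W] by simp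
    also have "col (A * W) 0 = e \<cdot>\<^sub>v col W 0"
      unfolding eigW[symmetric] using A W n by (intro eq_vecI) auto
    also have "col W i \<bullet> (e \<cdot>\<^sub>v col W 0) = e * (W\<^sup>T * W) $$ (i, 0)"
      using W i n by simp
    finally show ?thesis using i n by (simp add: WW)
  qed
  have B0': "B $$ (0, i) = (if i = 0 then e else 0)" if i: "i < n" for i
    using B0[OF i] arg_cong[OF symB, of "\<lambda>M. M $$ (0, i)"] B i n by (auto split: if_splits)
  define C where "C = mat k k (\<lambda>(i, j). B $$ (Suc i, Suc j))"
  have C: "C \<in> carrier_mat k k" by (simp add: C_def)
  define E where "E = mat 1 1 (\<lambda>_. e)"
  have E: "E \<in> carrier_mat 1 1" by (simp add: E_def)
  have blockB: "B = four_block_mat E (0\<^sub>m 1 k) (0\<^sub>m k 1) C"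
    using B B0 B0' n by (intro eq_matI) (auto simp: E_def C_def)
  have symC: "C\<^sup>T = C"
  proof (rule eq_matI)
    fix i j assume "i < dim_row C" "j < dim_col C"
    thus "C\<^sup>T $$ (i, j) = C $$ (i, j)"
      using arg_cong[OF symB, of "\<lambda>M. M $$ (Suc i, Suc j)"] B n by (simp add: C_def)
  qed (auto simp: C_def)
  \<comment> \<open>Similarity preserves the characteristic polynomial and the block form factors
    it; cancelling the factor of \<open>e\<close> leaves the roots \<open>es\<close> for
    \<open>C\<close>.\<close>
  have "similar_mat_wit B A (W\<^sup>T) W"
    by (rule similar_mat_witI[of _ _ n]) (use W A WW WW' B_def in auto)
  hence "similar_mat B A" unfolding similar_mat_def by blast
  hence "char_poly B = [:- e, 1:] * (\<Prod>e\<leftarrow>es. [:- e, 1:])" using char_poly_similar cp by force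
  moreover have "char_poly B = char_poly E * char_poly C"
    unfolding blockB by (rule char_poly_four_block_zeros_col[OF E zero_carrier_mat C])
  moreover have "char_poly E = [:- e, 1:]"
    by (simp add: E_def char_poly_defs det_def sign_def)
  ultimately have "char_poly C = (\<Prod>e\<leftarrow>es. [:- e, 1:])"
    by (metis mult_cancel_left pCons_eq_0_iff zero_neq_one)
  from Cons.IH[OF C symC this] obtain R where R: "R \<in> carrier_mat k k"
    and RR: "R\<^sup>T * R = 1\<^sub>m k" and RCR: "R\<^sup>T * C * R = mat_diag k (\<lambda>i. es ! i)"
    by blast
  \<comment> \<open>Extending \<open>R\<close> by the identity on the split-off coordinate
    diagonalizes \<open>B\<close>, so \<open>W * S\<close> diagonalizes \<open>A\<close>.\<close>
  define S where "S = four_block_mat (1\<^sub>m 1) (0\<^sub>m 1 k) (0\<^sub>m k 1) R"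
  have S: "S \<in> carrier_mat n n" unfolding S_def n using R by (intro four_block_carrier_mat) auto
  have ST: "S\<^sup>T = four_block_mat (1\<^sub>m 1) (0\<^sub>m 1 k) (0\<^sub>m k 1) (R\<^sup>T)"
    unfolding S_def by (subst transpose_four_block_mat[of _ 1 1 _ k _ k]) (use R in auto)
  have SS: "S\<^sup>T * S = 1\<^sub>m n"
    unfolding ST unfolding S_def
    by (subst mult_four_block_mat[of _ 1 1 _ k _ k _ _ 1 _ k]) (use R RR n in auto)
  have "S\<^sup>T * B * S = four_block_mat E (0\<^sub>m 1 k) (0\<^sub>m k 1) (R\<^sup>T * C * R)"
    unfolding ST blockB unfolding S_def
    using R C E
    by (subst mult_four_block_mat[of _ 1 1 _ k _ k _ _ 1 _ k], (simp; fail)+)+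
  also have "\<dots> = mat_diag n (\<lambda>i. (e # es) ! i)"
    unfolding RCR using n by (intro eq_matI) (auto simp: mat_diag_def E_def)
  finally have SBS: "S\<^sup>T * B * S = mat_diag n (\<lambda>i. (e # es) ! i)" .
  have T: "(W * S)\<^sup>T = S\<^sup>T * W\<^sup>T" by (rule transpose_mult[OF W S])
  have "(W * S)\<^sup>T * (W * S) = S\<^sup>T * (W\<^sup>T * W) * S"
    unfolding T using W S by (simp add: assoc_mult_mat[of _ n n _ n _ n])
  hence "(W * S)\<^sup>T * (W * S) = 1\<^sub>m n" using S by (simp add: WW SS)
  moreover have "(W * S)\<^sup>T * A * (W * S) = S\<^sup>T * B * S"
    unfolding T B_def using W S A by (simp add: assoc_mult_mat[of _ n n _ n _ n])
  ultimately show ?case using SBS W S by (intro bexI[of _ "W * S"]) auto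
qed

text \<open>Over the complex numbers the polynomial splits. An eigenvector \<open>v\<close> for a
  root \<open>z\<close> evaluates the Hermitian form of \<open>A\<close> both to \<open>z\<close>
  and to \<open>cnj z\<close> times the squared norm of \<open>v\<close>, so every root is
  real.\<close>

lemma real_symmetric_char_poly_splits:
  fixes A :: "real mat"
  assumes A: "A \<in> carrier_mat n n" and sym: "A\<^sup>T = A"
  shows "\<exists>es. char_poly A = (\<Prod>e\<leftarrow>es. [:- e, 1:])"
proof -
  interpret h: map_poly_inj_idom_hom complex_of_real ..
  let ?c = "map_mat complex_of_real A"
  have cA: "?c \<in> carrier_mat n n" using A by simp
  from char_poly_factorized[OF cA] obtain zs
    where zs: "char_poly ?c = (\<Prod>z\<leftarrow>zs. [:- z, 1:])" by auto
  have real: "z \<in> \<real>" if "z \<in> set zs" for z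
  proof -
    have "poly (char_poly ?c) z = 0"
      unfolding zs poly_prod_list prod_list_zero_iff using that by (auto intro!: image_eqI[of _ _ z])
    hence "eigenvalue ?c z" unfolding eigenvalue_root_char_poly[OF cA] .
    then obtain v where v: "v \<in> carrier_vec n" "v \<noteq> 0\<^sub>v n" and ev: "?c *\<^sub>v v = z \<cdot>\<^sub>v v"
      using A unfolding eigenvalue_def eigenvector_def by auto
    have cv: "conjugate v \<in> carrier_vec n" using v by simp
    have cAv: "?c *\<^sub>v conjugate v = conjugate (?c *\<^sub>v v)"
      using A v by (intro eq_vecI) (auto simp: scalar_prod_def)
    have cT: "?c\<^sup>T = ?c" using sym by (metis map_mat_transpose)
    have "z * (v \<bullet>c v) = (?c *\<^sub>v v) \<bullet>c v" using v cv by (simp add: ev)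
    also have "\<dots> = v \<bullet> (?c *\<^sub>v conjugate v)"
      using transpose_vec_mult_scalar[OF cA cv v(1)] cT cA v cv
      by (metis comm_scalar_prod mult_mat_vec_carrier)
    also have "\<dots> = cnj z * (v \<bullet>c v)"
      unfolding cAv ev using v cv by (simp add: conjugate_smult_vec)
    finally have "z * (v \<bullet>c v) = cnj z * (v \<bullet>c v)" .
    moreover have "v \<bullet>c v \<noteq> 0" using conjugate_square_eq_0_vec[OF v(1)] v(2) by simp
    ultimately show ?thesis by (simp add: Reals_cnj_iff)
  qed
  define es where "es = map Re zs"
  \<comment> \<open>The embedding of real into complex polynomials is injective, so the complex
    factorization descends.\<close>
  have "map_poly complex_of_real (char_poly A) = char_poly ?c"
    by (rule of_real_hom.char_poly_hom[OF A, symmetric])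
  also have "\<dots> = (\<Prod>e\<leftarrow>es. [:- complex_of_real e, 1:])"
    unfolding zs es_def map_map o_def
    by (intro arg_cong[of _ _ prod_list] map_cong) (use real in \<open>auto simp: complex_is_Real_iff complex_eq_iff\<close>)
  also have "(\<Prod>e\<leftarrow>es. [:- complex_of_real e, 1:]) = map_poly complex_of_real (\<Prod>e\<leftarrow>es. [:- e, 1:])"
    by (simp add: h.hom_prod_list o_def hom_distribs)
  finally show ?thesis by auto
qed

text \<open>As the polynomial splits over the reals, \<open>proots\<close> misses no root, and
  sorting only permutes commuting factors.\<close>

lemma char_poly_eigenvalues_desc:
  assumes "A \<in> carrier_mat n n" and "A\<^sup>T = A"
  shows "char_poly A = (\<Prod>e\<leftarrow>eigenvalues_desc A. [:- e, 1:])"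
proof -
  from real_symmetric_char_poly_splits[OF assms] obtain es
    where es: "char_poly A = (\<Prod>e\<leftarrow>es. [:- e, 1:])" by blast
  have "proots (\<Prod>e\<leftarrow>es. [:- e, 1:]) = mset es"
  proof (induction es)
    case (Cons e es)
    thus ?case using proots_mult[OF _ linear_factors_nonzero, of "[:- e, 1:]" es] by simp
  qed simp
  hence "mset (eigenvalues_desc A) = mset es" by (simp add: eigenvalues_desc_def es)
  hence "mset (map (\<lambda>e. [:- e, 1:]) (eigenvalues_desc A)) = mset (map (\<lambda>e. [:- e, 1:]) es)" by simp
  thus ?thesis unfolding es by (metis prod_mset_prod_list)
qed

section \<open>Sums of leading eigenvalues\<close>

text \<open>With each weight at most 1 and total weight at most \<open>k\<close>, the best choice
  puts weight 1 on the \<open>k\<close> largest entries. The proof compares every entry with a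
  threshold.\<close>

lemma sum_weighted_le_sum_leading:
  fixes q t :: "nat \<Rightarrow> real"
  assumes desc: "\<And>i j. i \<le> j \<Longrightarrow> j < n \<Longrightarrow> q j \<le> q i" and q: "\<And>i. i < n \<Longrightarrow> 0 \<le> q i"
    and t: "\<And>i. i < n \<Longrightarrow> 0 \<le> t i" "\<And>i. i < n \<Longrightarrow> t i \<le> 1"
    and sum_t: "(\<Sum>i<n. t i) \<le> real k" and k: "k \<le> n"
  shows "(\<Sum>i<n. q i * t i) \<le> (\<Sum>i<k. q i)"
proof (cases "k = 0")
  case True
  have "t i = 0" if i: "i < n" for i
  proof -
    have "t i \<le> (\<Sum>i<n. t i)" using t(1) i by (intro member_le_sum) auto
    thus ?thesis using sum_t t(1)[OF i] True by simp
  qed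
  thus ?thesis using True by simp
next
  case False
  \<comment> \<open>Index \<open>k - 1\<close> holds the k-th largest value, hence the separate case
    \<open>k = 0\<close>.\<close>
  define \<theta> where "\<theta> = q (k - 1)"
  have \<theta>: "0 \<le> \<theta>" using q False k by (simp add: \<theta>_def)
  \<comment> \<open>Before index \<open>k\<close> the excess over \<theta> is nonnegative and its
    weight is raised to 1; from \<open>k\<close> on it is nonpositive and dropped.\<close>
  have "q i * t i \<le> \<theta> * t i + (if i < k then q i - \<theta> else 0)" if i: "i < n" for i
  proof (cases "i < k")
    case True
    hence "\<theta> \<le> q i" using desc[of i "k - 1"] k by (simp add: \<theta>_def)
    hence "(q i - \<theta>) * t i \<le> q i - \<theta>" using t(2)[OF i] by (simp add: mult_left_le)
    thus ?thesis using True by (simp add: algebra_simps)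
  next
    case False
    hence "q i \<le> \<theta>" using desc[of "k - 1" i] i by (simp add: \<theta>_def)
    thus ?thesis using t(1)[OF i] False by (simp add: mult_right_mono)
  qed
  hence "(\<Sum>i<n. q i * t i) \<le> (\<Sum>i<n. \<theta> * t i + (if i < k then q i - \<theta> else 0))"
    by (intro sum_mono) simp
  also have "\<dots> = \<theta> * (\<Sum>i<n. t i) + (\<Sum>i<n. if i < k then q i - \<theta> else 0)"
    by (simp add: sum.distrib sum_distrib_left)
  also have "(\<Sum>i<n. if i < k then q i - \<theta> else 0) = (\<Sum>i<k. q i - \<theta>)"
    by (rule sum.mono_neutral_cong_right) (use k in auto)
  also have "\<dots> = (\<Sum>i<k. q i) - real k * \<theta>" by (simp add: sum_subtractf)
  finally show ?thesis using mult_left_mono[OF sum_t \<theta>] by (simp add: mult.commute)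
qed

text \<open>
  The weights \<open>c i / q i\<close>, with \<open>c i\<close> the sum of the \<open>(a i u)\<^sup>2\<close> over \<open>u\<close>, lie in [0, 1]. Their
  contribution \<open>s\<close> from a single \<open>u\<close> satisfies \<open>s\<^sup>2 \<le> s\<close>, by evaluating \<open>dom\<close> at
  \<open>x i = a i u / q i\<close>, so they sum up to at most \<open>card U\<close>. If \<open>q i = 0\<close>, then \<open>c i = 0\<close> and the
  convention \<open>0 / 0 = 0\<close> gives the right weight.
\<close>

lemma sum_squares_le_sum_leading:
  fixes q :: "nat \<Rightarrow> real" and a :: "nat \<Rightarrow> 'u \<Rightarrow> real"
  assumes desc: "\<And>i j. i \<le> j \<Longrightarrow> j < n \<Longrightarrow> q j \<le> q i"
    and U: "finite U" "card U \<le> k" and k: "k \<le> n"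
    and dom: "\<And>x. (\<Sum>u\<in>U. (\<Sum>i<n. x i * a i u)\<^sup>2) \<le> (\<Sum>i<n. q i * (x i)\<^sup>2)"
  shows "(\<Sum>u\<in>U. \<Sum>i<n. (a i u)\<^sup>2) \<le> (\<Sum>i<k. q i)"
proof -
  define c where "c i = (\<Sum>u\<in>U. (a i u)\<^sup>2)" for i
  \<comment> \<open>Evaluates \<open>dom\<close> at the i-th unit vector. As \<open>c i\<close> is a
    sum of squares, this also yields \<open>0 \<le> q i\<close>.\<close>
  have c: "c i \<le> q i" if "i < n" for i
  proof -
    have single: "(\<Sum>j<n. (if j = i then 1 else 0) * f j) = f i" for f :: "nat \<Rightarrow> real"
      using that by (subst sum.mono_neutral_cong_right[of "{..<n}" "{i}" _ f]) auto
    have "(\<Sum>j<n. q j * (if j = i then 1 else 0)\<^sup>2) = q i"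
      using that by (subst sum.mono_neutral_cong_right[of "{..<n}" "{i}" _ q]) auto
    thus ?thesis using dom[of "\<lambda>j. if j = i then 1 else 0"] by (simp only: single c_def)
  qed
  have c0: "0 \<le> c i" for i by (simp add: c_def sum_nonneg)
  have q0: "0 \<le> q i" if "i < n" for i using c[OF that] c0[of i] by simp
  have row: "(\<Sum>i<n. (a i u)\<^sup>2 / q i) \<le> 1" (is "?s \<le> 1") if u: "u \<in> U" for u
  proof -
    have "?s\<^sup>2 = (\<Sum>i<n. a i u / q i * a i u)\<^sup>2" by (simp add: power2_eq_square)
    also have "\<dots> \<le> (\<Sum>v\<in>U. (\<Sum>i<n. a i u / q i * a i v)\<^sup>2)"
      using U(1) u by (intro member_le_sum) auto
    also have "\<dots> \<le> (\<Sum>i<n. q i * (a i u / q i)\<^sup>2)" by (rule dom)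
    also have "\<dots> = ?s" by (intro sum.cong) (auto simp: power2_eq_square)
    finally have "?s * ?s \<le> 1 * ?s" by (simp add: power2_eq_square)
    thus ?thesis by (simp only: mult_le_cancel_right) linarith
  qed
  have "(\<Sum>i<n. c i / q i) = (\<Sum>u\<in>U. \<Sum>i<n. (a i u)\<^sup>2 / q i)"
    unfolding c_def sum_divide_distrib by (rule sum.swap)
  also have "\<dots> \<le> real (card U)" using sum_mono[OF row] by simp
  finally have total: "(\<Sum>i<n. c i / q i) \<le> real k" using U(2) by simp
  have "(\<Sum>u\<in>U. \<Sum>i<n. (a i u)\<^sup>2) = (\<Sum>i<n. c i)" unfolding c_def by (rule sum.swap)
  also have "\<dots> = (\<Sum>i<n. q i * (c i / q i))"
  proof (intro sum.cong refl)
    fix i assume "i \<in> {..<n}"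
    thus "c i = q i * (c i / q i)" using c[of i] c0[of i] by (cases "q i = 0") auto
  qed
  also have "\<dots> \<le> (\<Sum>i<k. q i)"
    by (rule sum_weighted_le_sum_leading[OF desc q0 _ _ total k])
      (use c c0 q0 in \<open>auto simp: divide_le_eq_1 order_less_le\<close>)
  finally show ?thesis .
qed

text \<open>Coordinates in an orthonormal eigenbasis preserve scalar products and turn the form of
  \<open>A\<close> into a weighted sum of squares, the setting of
  \<open>sum_squares_le_sum_leading\<close>.\<close>

lemma sum_norms_le_sum_eigenvalues:
  fixes A :: "real mat" and y :: "'u \<Rightarrow> real vec"
  assumes A: "A \<in> carrier_mat n n" and sym: "A\<^sup>T = A"
    and U: "finite U" "card U \<le> k" and k: "k \<le> n"
    and y: "\<And>u. u \<in> U \<Longrightarrow> y u \<in> carrier_vec n"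
    and dom: "\<And>x. x \<in> carrier_vec n \<Longrightarrow> (\<Sum>u\<in>U. (x \<bullet> y u)\<^sup>2) \<le> x \<bullet> (A *\<^sub>v x)"
  shows "(\<Sum>u\<in>U. y u \<bullet> y u) \<le> (\<Sum>i<k. eigenvalues_desc A ! i)"
proof -
  let ?es = "eigenvalues_desc A"
  note cp = char_poly_eigenvalues_desc[OF A sym]
  have len: "length ?es = n" by (rule length_linear_factors_char_poly[OF A cp])
  have "sorted (rev ?es)" by (simp add: eigenvalues_desc_def)
  hence desc: "?es ! j \<le> ?es ! i" if "i \<le> j" "j < n" for i j
    using sorted_rev_nth_mono that len by metis
  from real_symmetric_diagonalization[OF A sym cp] obtain P where P: "P \<in> carrier_mat n n"
    and PP: "P\<^sup>T * P = 1\<^sub>m n" and PAP: "P\<^sup>T * A * P = mat_diag n (\<lambda>i. ?es ! i)"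
    by blast
  note PP' = orthogonal_mat_inverse[OF P PP]
  have PT: "P\<^sup>T \<in> carrier_mat n n" using P by simp
  have adj: "(P *\<^sub>v c) \<bullet> z = c \<bullet> (P\<^sup>T *\<^sub>v z)" if "c \<in> carrier_vec n" "z \<in> carrier_vec n" for c z
    using transpose_vec_mult_scalar[OF PT that(2,1)] that P PT
    by simp
  define a where "a i u = (P\<^sup>T *\<^sub>v y u) $ i" for i u
  have norm: "y u \<bullet> y u = (\<Sum>i<n. (a i u)\<^sup>2)" if u: "u \<in> U" for u
  proof -
    have "y u \<bullet> y u = (P *\<^sub>v (P\<^sup>T *\<^sub>v y u)) \<bullet> y u"
      unfolding assoc_mult_mat_vec[OF P PT y[OF u], symmetric] PP' using y[OF u] by simp
    also have "\<dots> = (P\<^sup>T *\<^sub>v y u) \<bullet> (P\<^sup>T *\<^sub>v y u)"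
      using y[OF u] PT by (intro adj) auto
    finally show ?thesis
      using P by (simp add: scalar_prod_def a_def power2_eq_square atLeast0LessThan)
  qed
  have "(\<Sum>u\<in>U. (\<Sum>i<n. x i * a i u)\<^sup>2) \<le> (\<Sum>i<n. ?es ! i * (x i)\<^sup>2)" for x :: "nat \<Rightarrow> real"
  proof -
    define c where "c = vec n x"
    have c: "c \<in> carrier_vec n" and Pc: "P *\<^sub>v c \<in> carrier_vec n" using P by (auto simp: c_def)
    have "(\<Sum>u\<in>U. (\<Sum>i<n. x i * a i u)\<^sup>2) = (\<Sum>u\<in>U. ((P *\<^sub>v c) \<bullet> y u)\<^sup>2)"
    proof (intro sum.cong refl)
      fix u assume u: "u \<in> U"
      show "(\<Sum>i<n. x i * a i u)\<^sup>2 = ((P *\<^sub>v c) \<bullet> y u)\<^sup>2"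
        unfolding adj[OF c y[OF u]] using P by (simp add: scalar_prod_def a_def c_def atLeast0LessThan)
    qed
    also have "\<dots> \<le> (P *\<^sub>v c) \<bullet> (A *\<^sub>v (P *\<^sub>v c))" by (rule dom[OF Pc])
    also have "\<dots> = c \<bullet> (P\<^sup>T *\<^sub>v (A *\<^sub>v (P *\<^sub>v c)))" using c A P by (intro adj) auto
    also have "P\<^sup>T *\<^sub>v (A *\<^sub>v (P *\<^sub>v c)) = (P\<^sup>T * A * P) *\<^sub>v c"
      using A P PT c by (simp add: assoc_mult_mat_vec[of _ n n _ n])
    also have "\<dots> = vec n (\<lambda>i. ?es ! i * x i)"
      unfolding PAP
      by (intro eq_vecI)
        (auto simp: mat_diag_def c_def scalar_prod_def if_distrib[of "\<lambda>z. z * _"] cong: if_cong)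
    also have "c \<bullet> \<dots> = (\<Sum>i<n. ?es ! i * (x i)\<^sup>2)"
      by (simp add: c_def scalar_prod_def power2_eq_square atLeast0LessThan mult_ac)
    finally show ?thesis .
  qed
  from sum_squares_le_sum_leading[OF desc U k this]
  show ?thesis using norm by simp
qed

section \<open>Stars and the signless Laplacian\<close>

lemma edges_conv: "edges G = (\<lambda>(u, w). {u, w}) ` arcs_ends G"
  by (auto simp: edges_def arcs_ends_conv image_iff)

lemma arcs_ends_induce_subgraph:
  "arcs_ends (G \<restriction> U) = arcs_ends G \<inter> U \<times> U"
  by (auto simp: arcs_ends_conv)

context graph
begin

lemma arcs_ends_subset: "arcs_ends G \<subseteq> verts G \<times> verts G"
  by (auto simp: arcs_ends_conv)

lemma finite_arcs_ends: "finite (arcs_ends G)"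
  by (simp add: arcs_ends_conv)

lemma finite_neighbours: "finite {w. u \<rightarrow> w}"
  by (rule finite_subset[OF _ finite_verts]) (use arcs_ends_subset in auto)

lemma dominates_sym: "u \<rightarrow> w \<Longrightarrow> w \<rightarrow> u"
  using arcs_ends_symmetric[OF sym_arcs] .

lemma out_degree_conv: "out_degree G u = card {w. u \<rightarrow> w}"
proof -
  have "inj_on (head G) (out_arcs G u)"
    by (auto simp: inj_on_def arc_to_ends_def intro: no_multi_arcs)
  moreover have "head G ` out_arcs G u = {w. u \<rightarrow> w}" by (auto simp: arcs_ends_conv)
  ultimately show ?thesis unfolding out_degree_def by (metis card_image)
qed

text \<open>A walk from \<open>U\<close> to a vertex outside must leave \<open>U\<close> somewhere.
  \<open>connected\<close> speaks of the symmetric closure, which has the same reachability here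
  because arcs come in opposite pairs.\<close>

lemma exists_crossing_arc:
  assumes "connected G" and "U \<subset> verts G" and "U \<noteq> {}"
  shows "\<exists>u\<in>U. \<exists>w. w \<notin> U \<and> u \<rightarrow> w"
proof -
  from assms obtain a b where a: "a \<in> U" and b: "b \<in> verts G - U" by auto
  with assms have "a \<rightarrow>\<^sup>*\<^bsub>mk_symmetric G\<^esub> b"
    unfolding connected_def strongly_connected_def by auto
  hence "a \<rightarrow>\<^sup>* b" unfolding reachable_mk_symmetric_eq[OF sym_arcs] .
  hence "b \<notin> U \<longrightarrow> a \<in> U \<longrightarrow> ?thesis" by induct auto
  thus ?thesis using a b by blast
qed

lemma card_edges_induce_insert:
  assumes "u \<notin> U"
  shows "card (edges (G \<restriction> insert u U)) = card (edges (G \<restriction> U)) + card {w \<in> U. u \<rightarrow> w}"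
proof -
  have "edges (G \<restriction> insert u U) = edges (G \<restriction> U) \<union> (\<lambda>w. {u, w}) ` {w \<in> U. u \<rightarrow> w}"
    unfolding edges_conv arcs_ends_induce_subgraph
    using adj_not_same dominates_sym by (auto simp: image_iff doubleton_eq_iff)
  moreover have "edges (G \<restriction> U) \<inter> (\<lambda>w. {u, w}) ` {w \<in> U. u \<rightarrow> w} = {}"
    unfolding edges_conv arcs_ends_induce_subgraph using assms by (auto simp: doubleton_eq_iff)
  moreover have "finite (edges (G \<restriction> U))"
    unfolding edges_conv arcs_ends_induce_subgraph using finite_arcs_ends by simp
  moreover have "finite {w \<in> U. u \<rightarrow> w}"
    by (rule finite_subset[OF _ finite_neighbours[of u]]) auto
  moreover have "inj_on (\<lambda>w. {u, w}) {w \<in> U. u \<rightarrow> w}"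
    by (auto simp: inj_on_def doubleton_eq_iff)
  ultimately show ?thesis by (simp add: card_Un_disjoint card_image)
qed

text \<open>Vertices are peeled off \<open>U\<close> one by one, each with a neighbour outside the
  current set. By the second condition no edge inside \<open>U\<close> lies in two stars. As the
  degree sum counts these edges twice, the third condition then says that every edge meeting
  \<open>U\<close> is used exactly once.\<close>

lemma exists_star_partition:
  assumes conn: "connected G" and "U \<subset> verts G"
  shows "\<exists>S. (\<forall>u\<in>U. S u \<noteq> {} \<and> S u \<subseteq> {w. u \<rightarrow> w}) \<and>
    (\<forall>u\<in>U. \<forall>w\<in>U. w \<in> S u \<longrightarrow> u \<notin> S w) \<and>
    (\<Sum>u\<in>U. card (S u)) + card (edges (G \<restriction> U)) = (\<Sum>u\<in>U. out_degree G u)"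
proof -
  have "finite U" using assms(2) finite_verts finite_subset by blast
  thus ?thesis using assms(2)
  proof (induction U rule: finite_psubset_induct)
    case (psubset U)
    show ?case
    proof (cases "U = {}")
      case True
      thus ?thesis by (simp add: edges_def)
    next
      case False
      from exists_crossing_arc[OF conn psubset.prems False] obtain u z
        where u: "u \<in> U" and z: "z \<notin> U" "u \<rightarrow> z" by blast
      define U' where "U' = U - {u}"
      have U: "U = insert u U'" and uU': "u \<notin> U'" using u by (auto simp: U'_def)
      have fin: "finite U'" using psubset.hyps by (simp add: U'_def)
      have "U' \<subset> U" "U' \<subset> verts G" using u psubset.prems by (auto simp: U'_def)
      from psubset.IH[OF this] obtain S
        where S: "\<forall>v\<in>U'. S v \<noteq> {} \<and> S v \<subseteq> {w. v \<rightarrow> w}"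
          and asym: "\<forall>v\<in>U'. \<forall>w\<in>U'. w \<in> S v \<longrightarrow> v \<notin> S w"
          and count: "(\<Sum>v\<in>U'. card (S v)) + card (edges (G \<restriction> U')) = (\<Sum>v\<in>U'. out_degree G v)"
        by blast
      \<comment> \<open>The edges between \<open>u\<close> and the rest of \<open>U\<close> belong to the stars of the rest; the edge
        to \<open>z\<close> remains for \<open>u\<close>.\<close>
      define S' where "S' = S(u := {w. u \<rightarrow> w} - U')"
      have "\<forall>v\<in>U. S' v \<noteq> {} \<and> S' v \<subseteq> {w. v \<rightarrow> w}"
        using S z by (auto simp: S'_def U)
      moreover have "\<forall>v\<in>U. \<forall>w\<in>U. w \<in> S' v \<longrightarrow> v \<notin> S' w"
        using asym uU' adj_not_same by (auto simp: S'_def U)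
      moreover have "(\<Sum>v\<in>U. card (S' v)) + card (edges (G \<restriction> U)) = (\<Sum>v\<in>U. out_degree G v)"
      proof -
        have "(\<Sum>v\<in>U'. card (S' v)) = (\<Sum>v\<in>U'. card (S v))"
          by (rule sum.cong) (use uU' in \<open>auto simp: S'_def\<close>)
        \<comment> \<open>\<open>S' u\<close> omits precisely the neighbours in \<open>U'\<close>,
          and the edges to these are the ones that \<open>card_edges_induce_insert\<close> adds;
          together they restore the degree of \<open>u\<close>.\<close>
        moreover have "card (S' u) + card {w \<in> U'. u \<rightarrow> w} = out_degree G u"
        proof -
          have "card {w. u \<rightarrow> w} = card ({w. u \<rightarrow> w} \<inter> U') + card ({w. u \<rightarrow> w} - U')"
            by (subst card_Un_disjoint[symmetric]) (auto simp: finite_neighbours intro!: arg_cong[of _ _ card])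
          moreover have "{w. u \<rightarrow> w} \<inter> U' = {w \<in> U'. u \<rightarrow> w}" by auto
          ultimately show ?thesis by (simp add: S'_def out_degree_conv)
        qed
        ultimately show ?thesis
          using count uU' fin by (simp add: U card_edges_induce_insert)
      qed
      ultimately show ?thesis by blast
    qed
  qed
qed

text \<open>Expanding the squares, the pure terms collect into degrees and the mixed ones into
  adjacencies. The factor 2 arises because \<open>arcs_ends G\<close> contains each edge in both
  directions.\<close>

lemma signless_laplacian_quadratic_form:
  fixes f :: "'a \<Rightarrow> real"
  assumes "distinct vs" and "set vs = verts G"
  defines "x \<equiv> vec (length vs) (\<lambda>i. f (vs ! i))"
  shows "2 * (x \<bullet> (signless_laplacian vs G *\<^sub>v x)) = (\<Sum>(u, w)\<in>arcs_ends G. (f u + f w)\<^sup>2)"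
proof -
  let ?n = "length vs" and ?E = "arcs_ends G"
  let ?M = "\<lambda>u w. (if u = w then real (out_degree G u) else 0) + (if u \<rightarrow> w then 1 else 0)"
  have bij: "bij_betw ((!) vs) {0..<?n} (verts G)"
    using bij_betw_nth[OF assms(1), of "{0..<?n}" "verts G"] assms(2)
    by (simp add: atLeast0LessThan)
  have to_pairs: "(\<Sum>u\<in>verts G. \<Sum>w | u \<rightarrow> w. g u w) = (\<Sum>(u, w)\<in>?E. g u w)" for g :: "'a \<Rightarrow> 'a \<Rightarrow> real"
    by (subst sum.Sigma) (use arcs_ends_subset finite_neighbours in \<open>auto intro!: sum.cong\<close>)
  have deg: "(\<Sum>(u, w)\<in>?E. (f u)\<^sup>2) = (\<Sum>u\<in>verts G. real (out_degree G u) * (f u)\<^sup>2)"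
    unfolding to_pairs[symmetric] by (simp add: out_degree_conv)
  have swap: "(\<Sum>(u, w)\<in>?E. (f w)\<^sup>2) = (\<Sum>(u, w)\<in>?E. (f u)\<^sup>2)"
    by (rule sum.reindex_bij_witness[of _ prod.swap prod.swap]) (auto dest: dominates_sym)
  have "x \<bullet> (signless_laplacian vs G *\<^sub>v x) =
      (\<Sum>i\<in>{0..<?n}. \<Sum>j\<in>{0..<?n}. f (vs ! i) *
        (((if i = j then real (out_degree G (vs ! i)) else 0) +
          (if vs ! i \<rightarrow> vs ! j then 1 else 0)) * f (vs ! j)))"
    by (simp add: x_def scalar_prod_def signless_laplacian_def degree_mat_def adjacency_mat_def sum_distrib_left)
  \<comment> \<open>Distinctness of \<open>vs\<close> lets \<open>i = j\<close> be read as equality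
    of vertices, so both sums can be reindexed from positions to vertices.\<close>
  also have "\<dots> = (\<Sum>i\<in>{0..<?n}. \<Sum>j\<in>{0..<?n}. f (vs ! i) *
        (?M (vs ! i) (vs ! j) * f (vs ! j)))"
    using assms(1) by (intro sum.cong refl) (auto simp: nth_eq_iff_index_eq)
  also have "\<dots> = (\<Sum>u\<in>verts G. \<Sum>w\<in>verts G. f u * (?M u w * f w))"
    by (simp only: sum.reindex_bij_betw[OF bij, of "\<lambda>w. f _ * (?M _ w * f w)"]
      sum.reindex_bij_betw[OF bij, of "\<lambda>u. \<Sum>w\<in>verts G. f u * (?M u w * f w)"])
  also have "\<dots> = (\<Sum>u\<in>verts G. real (out_degree G u) * (f u)\<^sup>2 + (\<Sum>w | u \<rightarrow> w. f u * f w))"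
  proof (intro sum.cong refl)
    fix u assume u: "u \<in> verts G"
    have "(\<Sum>w\<in>verts G. f u * (?M u w * f w))
       = (\<Sum>w\<in>verts G. if u = w then real (out_degree G u) * (f u)\<^sup>2 else 0)
       + (\<Sum>w\<in>verts G. if u \<rightarrow> w then f u * f w else 0)"
      unfolding sum.distrib[symmetric] by (intro sum.cong) (auto simp: algebra_simps power2_eq_square)
    also have "(\<Sum>w\<in>verts G. if u \<rightarrow> w then f u * f w else 0) = (\<Sum>w | u \<rightarrow> w. f u * f w)"
      by (rule sum.mono_neutral_cong_right) (use arcs_ends_subset in auto)
    finally show "(\<Sum>w\<in>verts G. f u * (?M u w * f w))
       = real (out_degree G u) * (f u)\<^sup>2 + (\<Sum>w | u \<rightarrow> w. f u * f w)"
      using u by simp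
  qed
  also have "\<dots> = (\<Sum>(u, w)\<in>?E. (f u)\<^sup>2) + (\<Sum>(u, w)\<in>?E. f u * f w)"
    unfolding sum.distrib to_pairs deg ..
  finally have "2 * (x \<bullet> (signless_laplacian vs G *\<^sub>v x)) =
      (\<Sum>(u, w)\<in>?E. (f u)\<^sup>2) + (\<Sum>(u, w)\<in>?E. (f w)\<^sup>2) + 2 * (\<Sum>(u, w)\<in>?E. f u * f w)"
    unfolding swap by simp
  also have "\<dots> = (\<Sum>(u, w)\<in>?E. (f u + f w)\<^sup>2)"
    unfolding sum_distrib_left sum.distrib[symmetric]
    by (intro sum.cong) (auto simp: power2_eq_square algebra_simps)
  finally show ?thesis .
qed

text \<open>The star edges, directed from centre to leaf, and their reversals are disjoint sets of
  arcs by \<open>asym\<close>. Both have the same sum of squares, and all other arcs only add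
  nonnegative terms to the form.\<close>

lemma star_sums_le_signless_laplacian:
  fixes f :: "'a \<Rightarrow> real"
  assumes "distinct vs" and "set vs = verts G" and U: "finite U"
    and S: "\<And>u. u \<in> U \<Longrightarrow> S u \<subseteq> {w. u \<rightarrow> w}"
    and asym: "\<And>u w. u \<in> U \<Longrightarrow> w \<in> U \<Longrightarrow> w \<in> S u \<Longrightarrow> u \<notin> S w"
  defines "x \<equiv> vec (length vs) (\<lambda>i. f (vs ! i))"
  shows "(\<Sum>u\<in>U. \<Sum>w\<in>S u. (f u + f w)\<^sup>2) \<le> x \<bullet> (signless_laplacian vs G *\<^sub>v x)"
proof -
  let ?T = "Sigma U S"
  have fin: "finite (S u)" if "u \<in> U" for u
    using S[OF that] finite_neighbours finite_subset by blast
  have finT: "finite ?T" using U fin by auto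
  have disj: "?T \<inter> prod.swap ` ?T = {}" using asym by auto
  have sub: "?T \<union> prod.swap ` ?T \<subseteq> arcs_ends G" using S dominates_sym by fastforce
  let ?g = "\<lambda>(u, w). (f u + f w)\<^sup>2"
  have "sum ?g (prod.swap ` ?T) = sum ?g ?T"
    by (subst sum.reindex) (auto simp: add.commute intro!: sum.cong)
  hence "2 * sum ?g ?T = sum ?g (?T \<union> prod.swap ` ?T)"
    using finT disj by (simp add: sum.union_disjoint)
  also have "\<dots> \<le> sum ?g (arcs_ends G)"
    by (rule sum_mono2[OF finite_arcs_ends sub]) auto
  also have "\<dots> = 2 * (x \<bullet> (signless_laplacian vs G *\<^sub>v x))"
    unfolding x_def signless_laplacian_quadratic_form[OF assms(1,2)] ..
  finally show ?thesis using U fin by (simp add: sum.Sigma)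
qed

end

section \<open>Star vectors and the eigenvalue bound\<close>

lemma signless_laplacian_carrier:
  "signless_laplacian vs G \<in> carrier_mat (length vs) (length vs)"
  by (simp add: signless_laplacian_def degree_mat_def adjacency_mat_def)

lemma (in graph) signless_laplacian_symmetric:
  "(signless_laplacian vs G)\<^sup>T = signless_laplacian vs G"
  by (rule eq_matI)
    (auto simp: signless_laplacian_def degree_mat_def adjacency_mat_def dest: dominates_sym)

text \<open>The sum of the unsigned incidence vectors of the edges of the star, divided by
  \<open>sqrt (card S)\<close>. For nonempty \<open>S\<close> without \<open>u\<close> it is an
  eigenvector for the largest signless Laplacian eigenvalue \<open>card S + 1\<close> of the star,
  scaled so that its squared norm is this eigenvalue.\<close>

definition star_vec :: "'a set \<Rightarrow> 'a \<Rightarrow> 'a \<Rightarrow> real" where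
  "star_vec S u v = ((if v = u then real (card S) else 0) + (if v \<in> S then 1 else 0)) / sqrt (card S)"

lemma sum_mult_star_vec:
  assumes V: "finite V" "u \<in> V" "S \<subseteq> V"
  shows "(\<Sum>v\<in>V. f v * star_vec S u v) = (\<Sum>w\<in>S. f u + f w) / sqrt (card S)"
proof -
  have "(\<Sum>v\<in>V. f v * star_vec S u v) =
      ((\<Sum>v\<in>V. if v = u then real (card S) * f u else 0) + (\<Sum>v\<in>V. if v \<in> S then f v else 0)) / sqrt (card S)"
    unfolding sum.distrib[symmetric] sum_divide_distrib
    by (intro sum.cong) (auto simp: star_vec_def algebra_simps)
  also have "(\<Sum>v\<in>V. if v \<in> S then f v else 0) = sum f S"
    by (rule sum.mono_neutral_cong_right) (use V in auto)
  finally show ?thesis using V by (simp add: sum.distrib)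
qed

text \<open>Cauchy--Schwarz over the leaves costs a factor \<open>card S\<close>, which the square
  of the normalization cancels.\<close>

lemma sum_square_mult_star_vec_le:
  assumes "finite V" "u \<in> V" "S \<subseteq> V" "S \<noteq> {}"
  shows "(\<Sum>v\<in>V. f v * star_vec S u v)\<^sup>2 \<le> (\<Sum>w\<in>S. (f u + f w)\<^sup>2)"
proof -
  have "card S > 0" using assms by (meson card_gt_0_iff finite_subset)
  thus ?thesis
    using sum_squared_le_sum_of_squares[of "\<lambda>w. f u + f w" S]
    by (simp add: sum_mult_star_vec[OF assms(1-3)] power_divide pos_divide_le_eq)
qed

lemma norm_star_vec:
  assumes "finite V" "u \<in> V" "S \<subseteq> V" "S \<noteq> {}" "u \<notin> S"
  shows "(\<Sum>v\<in>V. star_vec S u v * star_vec S u v) = real (card S) + 1"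
proof -
  have c: "card S > 0" using assms by (meson card_gt_0_iff finite_subset)
  \<comment> \<open>Prepares \<open>sum_mult_star_vec\<close> for the star vector itself: on every
    edge the entries of centre and leaf have the same sum.\<close>
  have "(\<Sum>w\<in>S. star_vec S u u + star_vec S u w) = (\<Sum>w\<in>S. (real (card S) + 1) / sqrt (card S))"
    using assms(5) by (intro sum.cong) (auto simp: star_vec_def add_divide_distrib)
  thus ?thesis using c by (simp add: sum_mult_star_vec[OF assms(1-3)])
qed

theorem theorem4p6:
  fixes G :: "('a, 'b) pre_digraph" and U :: "'a set" and vs :: "'a list" and n m :: nat
  assumes "Digraph.graph G"
    and "connected G"
    and "distinct vs" and "set vs = verts G"
    and "card (verts G) = n" and "n \<ge> 3"
    and "U \<subseteq> verts G"
    and "card U = m" and "m < n"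
  shows "(\<Sum>i = 1..m + 1. q_eigenvalue vs G i)
    \<ge> (\<Sum>u\<in>U. real (out_degree G u)) + real m - real (card (edges (G \<restriction> U)))"
proof -
  interpret graph G by fact
  let ?Q = "signless_laplacian vs G"
  have len: "length vs = n" using assms(3,4,5) distinct_card by metis
  have U: "U \<subset> verts G" "finite U" using assms(5,7,8,9) finite_subset[OF assms(7)] by auto
  from exists_star_partition[OF assms(2) U(1)] obtain S
    where S: "\<And>u. u \<in> U \<Longrightarrow> S u \<noteq> {}" "\<And>u. u \<in> U \<Longrightarrow> S u \<subseteq> {w. u \<rightarrow>\<^bsub>G\<^esub> w}"
      and asym: "\<And>u w. u \<in> U \<Longrightarrow> w \<in> U \<Longrightarrow> w \<in> S u \<Longrightarrow> u \<notin> S w"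
      and count: "(\<Sum>u\<in>U. card (S u)) + card (edges (G \<restriction> U)) = (\<Sum>u\<in>U. out_degree G u)"
    by metis
  have star: "u \<in> verts G" "S u \<subseteq> verts G" "S u \<noteq> {}" "u \<notin> S u" if "u \<in> U" for u
    using S[OF that] that U(1) arcs_ends_subset adj_not_same by auto
  define y where "y u = vec n (\<lambda>i. star_vec (S u) u (vs ! i))" for u
  have bij: "bij_betw ((!) vs) {..<n} (verts G)"
    using bij_betw_nth[OF assms(3), of "{..<n}" "verts G"] assms(4) len by auto
  \<comment> \<open>Here \<open>k = m + 1\<close> while there are \<open>m\<close> star vectors,
    which \<open>card U \<le> k\<close> allows; \<open>m < n\<close> gives
    \<open>k \<le> n\<close>.\<close>
  have "(\<Sum>u\<in>U. y u \<bullet> y u) \<le> (\<Sum>i<m + 1. eigenvalues_desc ?Q ! i)"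
  proof (rule sum_norms_le_sum_eigenvalues[where n = n])
    fix x :: "real vec" assume x: "x \<in> carrier_vec n"
    \<comment> \<open>Reads the coordinate vector as a function on vertices by inverting the
      enumeration \<open>vs\<close>.\<close>
    define f where "f v = x $ inv_into {..<n} ((!) vs) v" for v
    have "inj_on ((!) vs) {..<n}" using bij by (rule bij_betw_imp_inj_on)
    hence f: "f (vs ! i) = x $ i" if "i < n" for i using that by (simp add: f_def inv_into_f_f)
    hence x_eq: "x = vec (length vs) (\<lambda>i. f (vs ! i))" using x by (intro eq_vecI) (auto simp: len)
    have "x \<bullet> y u = (\<Sum>v\<in>verts G. f v * star_vec (S u) u v)" for u
      unfolding sum.reindex_bij_betw[OF bij, symmetric]
      by (simp add: scalar_prod_def y_def f atLeast0LessThan)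
    hence "(\<Sum>u\<in>U. (x \<bullet> y u)\<^sup>2) \<le> (\<Sum>u\<in>U. \<Sum>w\<in>S u. (f u + f w)\<^sup>2)"
      by (auto intro!: sum_mono sum_square_mult_star_vec_le dest: star)
    also have "\<dots> \<le> x \<bullet> (?Q *\<^sub>v x)"
      using star_sums_le_signless_laplacian[OF assms(3,4) U(2) S(2) asym, of f]
      by (simp add: x_eq)
    finally show "(\<Sum>u\<in>U. (x \<bullet> y u)\<^sup>2) \<le> x \<bullet> (?Q *\<^sub>v x)" .
  qed (use assms(8,9) U signless_laplacian_symmetric signless_laplacian_carrier[of vs G] len in
      \<open>auto simp: y_def\<close>)
  moreover have "y u \<bullet> y u = real (card (S u)) + 1" if "u \<in> U" for u
  proof -
    have "y u \<bullet> y u = (\<Sum>v\<in>verts G. star_vec (S u) u v * star_vec (S u) u v)"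
      unfolding sum.reindex_bij_betw[OF bij, symmetric]
      by (simp add: scalar_prod_def y_def atLeast0LessThan)
    thus ?thesis using star[OF that] by (simp add: norm_star_vec)
  qed
  moreover have "(\<Sum>i = 1..m + 1. q_eigenvalue vs G i) = (\<Sum>i<m + 1. eigenvalues_desc ?Q ! i)"
    by (rule sum.reindex_bij_witness[of _ Suc "\<lambda>i. i - 1"]) (auto simp: q_eigenvalue_def)
  moreover have "(\<Sum>u\<in>U. real (out_degree G u)) =
      (\<Sum>u\<in>U. real (card (S u))) + real (card (edges (G \<restriction> U)))"
    using arg_cong[OF count, of real] by simp
  \<comment> \<open>The star sizes give the degree sum minus the inner edges, and the extra 1 of
    each star adds up to \<open>m\<close>.\<close>
  ultimately show ?thesis using assms(8) by (simp add: sum.distrib)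
qed

end
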